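(* Let $p$ be a real rooted polynomial of degree $n$ with all roots lying in $[-1,1]$ and with the roots (counted with multiplicity) summing to $0$. Then, for any real $c$ with $\frac{1}{2} \le c < 1$ such that $cn$ is an integer, all roots of $p^{(cn)}$ satisfy $$\operatorname{roots}(p^{(cn)}) \subset [-2\sqrt{c-c^2},\,2\sqrt{c-c^2}].$$
   Context: $p^{(k)}$ denotes the $k$-th derivative of $p$. *)

theory Defs
  imports Complex_Main "HOL-Computational_Algebra.Polynomial"
begin

text \<open>
  The roots of a real polynomial are its complex roots, counted with multiplicity. The library
  sets \<open>proots 0 = {#}\<close>, so this notion is meaningful only for nonzero polynomials.
\<close>

definition complex_roots :: "real poly \<Rightarrow> complex multiset" where
  "complex_roots p = proots (map_poly complex_of_real p)"

definition real_rooted :: "real poly \<Rightarrow> bool" where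
  "real_rooted p \<longleftrightarrow> p \<noteq> 0 \<and> set_mset (complex_roots p) \<subseteq> \<real>"

end

theory Submission
  imports Defs "HOL-Computational_Algebra.Fundamental_Theorem_Algebra"
begin

text \<open>
  For a polynomial \<open>p\<close> and a point \<open>b\<close> to the right of its roots consider the barrier
  \<open>p'(b) / p(b) = (\<Sum>x. 1 / (b - x))\<close>. If it is at most \<open>w\<close>, then by the Cauchy--Schwarz
  inequality \<open>p'\<close> has all its roots to the left of \<open>b - 1 / w\<close>, and its barrier at that point
  is again at most \<open>w\<close>. Hence the roots of the \<open>k\<close>-th derivative are less than \<open>b - k / w\<close>.
  For \<open>n\<close> roots in \<open>[-1, 1]\<close> with sum \<open>0\<close> the barrier at \<open>b > 1\<close> is at most
  \<open>w = n b / (b\<^sup>2 - 1)\<close>, which bounds the roots by \<open>(1 - c) b + c / b\<close>. This expression is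
  minimal at \<open>b = sqrt (c / (1 - c))\<close>, where its value is \<open>2 sqrt (c - c\<^sup>2)\<close>; and \<open>b \<ge> 1\<close>
  there because \<open>c \<ge> 1 / 2\<close>. The lower bound follows by reflection.
\<close>

subsection \<open>Products of linear factors\<close>

definition from_roots :: "'a::comm_ring_1 multiset \<Rightarrow> 'a poly" where
  "from_roots A = (\<Prod>x\<in>#A. [:- x, 1:])"

lemma from_roots_empty [simp]: "from_roots {#} = 1"
  by (simp add: from_roots_def)

lemma from_roots_add_mset [simp]: "from_roots (add_mset x A) = [:- x, 1:] * from_roots A"
  by (simp add: from_roots_def)

text \<open>These rules would expand a product with a linear factor, whereas the inductions over
  \<open>A\<close> need \<open>[:- x, 1:]\<close> intact.\<close>

declare mult_pCons_left [simp del] mult_pCons_right [simp del]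

lemma from_roots_nonzero [simp]: "from_roots (A :: 'a::idom multiset) \<noteq> 0"
  by (induction A) auto

lemma degree_from_roots [simp]: "degree (from_roots (A :: 'a::idom multiset)) = size A"
  by (induction A) (simp_all add: degree_mult_eq)

lemma proots_from_roots [simp]: "proots (from_roots (A :: 'a::idom multiset)) = A"
  by (induction A) (simp_all add: proots_mult)

lemma poly_from_roots_eq_0_iff [simp]:
  "poly (from_roots A) z = 0 \<longleftrightarrow> z \<in># A" for z :: "'a::idom"
  by (induction A) auto

lemma poly_from_roots_uminus:
  "poly (from_roots A) (- z) = (- 1) ^ size A * poly (from_roots (image_mset uminus A)) z"
  by (induction A) (auto simp: algebra_simps)

lemma poly_pderiv_from_roots:
  fixes z :: "'a::field"
  assumes "z \<notin># A"
  shows "poly (pderiv (from_roots A)) z = poly (from_roots A) z * (\<Sum>x\<in>#A. 1 / (z - x))"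
  using assms
proof (induction A)
  case (add a A)
  then show ?case by (simp add: pderiv_mult pderiv_pCons field_simps)
qed (simp add: pderiv_1)

text \<open>For \<open>L = f' / f\<close> one has \<open>f'' / f = L^2 + L'\<close>, and
  differentiating \<open>1 / (z - x)\<close> gives the negative squares.\<close>

lemma poly_pderiv_pderiv_from_roots:
  fixes z :: "'a::field"
  assumes "z \<notin># A"
  shows "poly (pderiv (pderiv (from_roots A))) z
    = poly (from_roots A) z * ((\<Sum>x\<in>#A. 1 / (z - x))\<^sup>2 - (\<Sum>x\<in>#A. 1 / (z - x)\<^sup>2))"
  using assms
proof (induction A)
  case (add a A)
  have za: "z - a \<noteq> 0" and zA: "z \<notin># A" using add.prems by auto
  define S T P where "S = (\<Sum>x\<in>#A. 1 / (z - x))" and "T = (\<Sum>x\<in>#A. 1 / (z - x)\<^sup>2)"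
    and "P = poly (from_roots A) z"
  have "poly (pderiv (pderiv ([:- a, 1:] * from_roots A))) z = 2 * (P * S) + (z - a) * (P * (S\<^sup>2 - T))"
    using add.IH[OF zA] poly_pderiv_from_roots[OF zA]
    by (simp add: pderiv_mult pderiv_add pderiv_pCons S_def T_def P_def)
  also have "\<dots> = ((z - a) * P) * ((1 / (z - a) + S)\<^sup>2 - (1 / (z - a)\<^sup>2 + T))"
  proof -
    define u where "u = z - a"
    have "u \<noteq> 0" using za by (simp add: u_def)
    then show ?thesis
      unfolding u_def[symmetric] by (simp add: field_simps power2_eq_square)
  qed
  finally show ?case by (simp add: S_def T_def P_def)
qed (simp add: pderiv_1)

subsection \<open>Real-rooted polynomials\<close>

lemma map_poly_of_real_mult:
  "map_poly complex_of_real (p * q) = map_poly complex_of_real p * map_poly complex_of_real q"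
  by (intro poly_eqI) (simp add: coeff_map_poly coeff_mult)

lemma map_poly_of_real_smult:
  "map_poly complex_of_real (smult a p) = smult (of_real a) (map_poly complex_of_real p)"
  by (intro poly_eqI) (simp add: coeff_map_poly)

lemma map_poly_of_real_pderiv:
  "map_poly complex_of_real (pderiv p) = pderiv (map_poly complex_of_real p)"
  by (intro poly_eqI) (simp add: coeff_map_poly coeff_pderiv)

lemma map_poly_of_real_from_roots:
  "map_poly complex_of_real (from_roots A) = from_roots (image_mset of_real A)"
  by (induction A)
    (simp_all add: map_poly_of_real_mult map_poly_pCons)

lemma map_poly_of_real_inject:
  "map_poly complex_of_real p = map_poly complex_of_real q \<longleftrightarrow> p = q"
  by (auto simp: poly_eq_iff coeff_map_poly)

lemma map_poly_of_real_eq_0_iff: "map_poly complex_of_real p = 0 \<longleftrightarrow> p = 0"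
  using map_poly_of_real_inject[of p 0] by simp

lemma complex_roots_smult_from_roots:
  assumes "a \<noteq> 0"
  shows "complex_roots (smult a (from_roots A)) = image_mset of_real A"
  using assms by (simp add: complex_roots_def map_poly_of_real_smult map_poly_of_real_from_roots)

lemma real_rooted_smult_from_roots:
  assumes "a \<noteq> 0"
  shows "real_rooted (smult a (from_roots A))"
  using assms by (auto simp: real_rooted_def complex_roots_smult_from_roots)

text \<open>Over the complex numbers \<open>p\<close> splits. Its roots are real, so the
  factorisation is the image of a real one, and the coefficient embedding is injective.\<close>

lemma real_rooted_decompose:
  assumes "real_rooted p"
  obtains a where "a \<noteq> 0" "p = smult a (from_roots (proots p))"
proof -
  let ?P = "map_poly complex_of_real p"
  define B where "B = image_mset Re (complex_roots p)"
  have "p \<noteq> 0" and R: "set_mset (complex_roots p) \<subseteq> \<real>"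
    using assms by (auto simp: real_rooted_def)
  have "image_mset of_real B = image_mset (\<lambda>z. z) (complex_roots p)"
    unfolding B_def multiset.map_comp using R by (intro image_mset_cong) auto
  then have "?P = smult (lead_coeff ?P) (from_roots (image_mset of_real B))"
    using complex_poly_decompose_multiset[of ?P] by (simp add: complex_roots_def from_roots_def)
  also have "lead_coeff ?P = of_real (lead_coeff p)"
    by (simp add: coeff_map_poly degree_map_poly)
  also have "smult (of_real (lead_coeff p)) (from_roots (image_mset of_real B))
      = map_poly complex_of_real (smult (lead_coeff p) (from_roots B))"
    by (simp add: map_poly_of_real_smult map_poly_of_real_from_roots)
  finally have eq: "p = smult (lead_coeff p) (from_roots B)"
    by (simp only: map_poly_of_real_inject)
  have "proots p = B"
    using \<open>p \<noteq> 0\<close> by (subst eq) simp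
  then show ?thesis using that eq \<open>p \<noteq> 0\<close> by (metis leading_coeff_0_iff)
qed

lemma size_proots_real_rooted:
  assumes "real_rooted p"
  shows "size (proots p) = degree p"
  using real_rooted_decompose[OF assms] by (metis degree_from_roots degree_smult_eq)

lemma complex_roots_real_rooted:
  assumes "real_rooted p"
  shows "complex_roots p = image_mset of_real (proots p)"
  using real_rooted_decompose[OF assms] by (metis complex_roots_smult_from_roots)

lemma sum_mset_pos:
  fixes f :: "'a \<Rightarrow> real"
  assumes "A \<noteq> {#}" "\<And>x. x \<in># A \<Longrightarrow> f x > 0"
  shows "(\<Sum>x\<in>#A. f x) > 0"
  using assms
proof (induction A)
  case (add a A)
  then show ?case by (cases "A = {#}") (auto intro: add_pos_pos)
qed simp

lemma sum_mset_nonneg: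
  fixes f :: "'a \<Rightarrow> real"
  assumes "\<And>x. x \<in># A \<Longrightarrow> f x \<ge> 0"
  shows "(\<Sum>x\<in>#A. f x) \<ge> 0"
  using assms by (induction A) auto

lemma Im_sum_mset: "Im (\<Sum>x\<in>#A. f x) = (\<Sum>x\<in>#A. Im (f x))"
  by (induction A) auto

text \<open>
  The Gauss--Lucas argument: off the roots, the imaginary part of \<open>p'(z) / p(z)\<close> is
  \<open>- Im z\<close> times a sum of positive terms.
\<close>

lemma real_rooted_pderiv:
  assumes "real_rooted p" and "degree p > 0"
  shows "real_rooted (pderiv p)"
proof -
  obtain a where a: "a \<noteq> 0" "p = smult a (from_roots (proots p))"
    using real_rooted_decompose[OF assms(1)] .
  define A where "A = proots p"
  have "A \<noteq> {#}" using assms size_proots_real_rooted[OF assms(1)] by (auto simp: A_def)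
  have nz: "pderiv p \<noteq> 0" using assms(2) by (simp add: pderiv_eq_0_iff)
  have "z \<in> \<real>" if z: "poly (map_poly complex_of_real (pderiv p)) z = 0" for z
  proof (rule ccontr)
    assume nR: "z \<notin> \<real>"
    then have notin: "z \<notin># image_mset of_real A" and Im: "Im z \<noteq> 0"
      by (auto simp: complex_is_Real_iff)
    have "map_poly complex_of_real p = smult (of_real a) (from_roots (image_mset of_real A))"
      using a(2) unfolding A_def by (metis map_poly_of_real_smult map_poly_of_real_from_roots)
    then have "poly (pderiv (from_roots (image_mset of_real A))) z = 0"
      using z a(1) by (simp add: map_poly_of_real_pderiv pderiv_smult)
    then have "(\<Sum>x\<in>#A. 1 / (z - of_real x)) = 0"
      using poly_pderiv_from_roots[OF notin] notin
      by (auto simp: multiset.map_comp comp_def)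
    then have "(\<Sum>x\<in>#A. Im (1 / (z - of_real x))) = 0"
      by (metis Im_sum_mset zero_complex.simps(2))
    moreover have "Im (1 / (z - of_real x)) = - Im z * (1 / (cmod (z - of_real x))\<^sup>2)" for x
      by (simp add: Im_divide cmod_power2)
    ultimately have "- Im z * (\<Sum>x\<in>#A. 1 / (cmod (z - of_real x))\<^sup>2) = 0"
      by (simp only: sum_mset_distrib_left)
    moreover have "(\<Sum>x\<in>#A. 1 / (cmod (z - of_real x))\<^sup>2) > 0"
      using \<open>A \<noteq> {#}\<close> nR by (intro sum_mset_pos) auto
    ultimately show False using Im by simp
  qed
  then show ?thesis
    using nz by (auto simp: real_rooted_def complex_roots_def map_poly_of_real_eq_0_iff)
qed

text \<open>The bound on \<open>k\<close> keeps every polynomial that gets differentiated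
  nonconstant.\<close>

lemma real_rooted_higher_pderiv:
  assumes "real_rooted p" and "k < degree p"
  shows "real_rooted ((pderiv ^^ k) p)"
  using assms
proof (induction k arbitrary: p)
  case (Suc k)
  then show ?case
    by (simp add: funpow_swap1 real_rooted_pderiv degree_pderiv)
qed simp

subsection \<open>The barrier argument\<close>

text \<open>Cauchy--Schwarz with nonnegative weights \<open>f\<close>, by induction on the
  multiset.\<close>

lemma sum_mset_mult_square_le:
  fixes f g :: "'a \<Rightarrow> real"
  assumes "\<And>x. x \<in># A \<Longrightarrow> f x \<ge> 0"
  shows "(\<Sum>x\<in>#A. f x * g x)\<^sup>2 \<le> (\<Sum>x\<in>#A. f x) * (\<Sum>x\<in>#A. f x * (g x)\<^sup>2)"
  using assms
proof (induction A)
  case (add a A)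
  define F G H where "F = (\<Sum>x\<in>#A. f x)" and "G = (\<Sum>x\<in>#A. f x * g x)"
    and "H = (\<Sum>x\<in>#A. f x * (g x)\<^sup>2)"
  have fa: "f a \<ge> 0" using add.prems by simp
  have IH: "G\<^sup>2 \<le> F * H" using add by (simp add: F_def G_def H_def)
  \<comment> \<open>Adding \<open>a\<close> enlarges the gap between the two sides by exactly
    \<open>f a\<close> times this sum.\<close>
  have "(\<Sum>x\<in>#A. f x * (g x - g a)\<^sup>2) \<ge> 0"
    using add.prems by (intro sum_mset_nonneg) auto
  also have "(\<Sum>x\<in>#A. f x * (g x - g a)\<^sup>2) = H - 2 * g a * G + (g a)\<^sup>2 * F"
    unfolding F_def G_def H_def
    by (induction A) (auto simp: algebra_simps power2_eq_square)
  finally have "f a * (H - 2 * g a * G + (g a)\<^sup>2 * F) \<ge> 0" using fa by simp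
  then have "(f a * g a + G)\<^sup>2 \<le> (f a + F) * (f a * (g a)\<^sup>2 + H)"
    using IH by (simp add: algebra_simps power2_eq_square)
  then show ?case by (simp add: F_def G_def H_def)
qed simp

lemma sum_mset_gt_member:
  fixes f :: "'a \<Rightarrow> real"
  assumes "x \<in># A" "\<And>x. x \<in># A \<Longrightarrow> f x > 0" "size A \<ge> 2"
  shows "f x < (\<Sum>x\<in>#A. f x)"
proof -
  obtain B where B: "A = add_mset x B" using assms(1) by (metis multi_member_split)
  have "(\<Sum>x\<in>#B. f x) > 0"
    using assms by (intro sum_mset_pos) (auto simp: B)
  then show ?thesis by (simp add: B)
qed

text \<open>
  With \<open>f x = 1 / (b - x)\<close> one has \<open>1 / (b - 1 / w - x) = f x * g x\<close> for
  \<open>g x = 1 / (1 - f x / w)\<close>, and the Cauchy--Schwarz inequality with weights \<open>f\<close> bounds \<open>S\<^sup>2\<close>.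
\<close>

lemma barrier_sum_shift:
  fixes A :: "real multiset"
  assumes sz: "size A \<ge> 2" and lt: "\<And>x. x \<in># A \<Longrightarrow> x < b" and w: "w > 0"
    and le: "(\<Sum>x\<in>#A. 1 / (b - x)) \<le> w"
  defines "b' \<equiv> b - 1 / w"
  shows "\<And>x. x \<in># A \<Longrightarrow> x < b'"
    and "(\<Sum>x\<in>#A. 1 / (b' - x))\<^sup>2 - (\<Sum>x\<in>#A. 1 / (b' - x)\<^sup>2) \<le> w * (\<Sum>x\<in>#A. 1 / (b' - x))"
proof -
  show lt': "x < b'" if x: "x \<in># A" for x
  proof -
    \<comment> \<open>Strict, because with at least two roots the other terms of the barrier are
      positive.\<close>
    have "1 / (b - x) < w"
      using sum_mset_gt_member[OF x, of "\<lambda>x. 1 / (b - x)"] lt sz le by fastforce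
    then show ?thesis using lt[OF x] w by (simp add: b'_def field_simps)
  qed
  define f g where "f x = 1 / (b - x)" and "g x = 1 / (1 - f x / w)" for x
  have fg: "1 / (b' - x) = f x * g x"
    and fg2: "f x * (g x)\<^sup>2 = 1 / (b' - x) + (1 / w) * (1 / (b' - x)\<^sup>2)"
    if x: "x \<in># A" for x
  proof -
    have d: "b - x > 0" "b' - x > 0" using lt[OF x] lt'[OF x] by auto
    have "1 - f x / w = (b' - x) / (b - x)"
      using d w by (simp add: f_def b'_def field_simps)
    then have g: "g x = (b - x) / (b' - x)" by (simp add: g_def)
    then show "1 / (b' - x) = f x * g x" using d by (simp add: f_def)
    have "f x * (g x)\<^sup>2 = (b - x) / (b' - x)\<^sup>2"
      using d by (simp add: g f_def power2_eq_square)
    also have "b - x = (b' - x) + 1 / w" by (simp add: b'_def)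
    finally show "f x * (g x)\<^sup>2 = 1 / (b' - x) + (1 / w) * (1 / (b' - x)\<^sup>2)"
      using d by (simp add: add_divide_distrib power2_eq_square)
  qed
  define S T where "S = (\<Sum>x\<in>#A. 1 / (b' - x))" and "T = (\<Sum>x\<in>#A. 1 / (b' - x)\<^sup>2)"
  have S: "S = (\<Sum>x\<in>#A. f x * g x)"
    unfolding S_def by (intro arg_cong[where f = sum_mset] image_mset_cong fg)
  have "(\<Sum>x\<in>#A. f x * (g x)\<^sup>2) = (\<Sum>x\<in>#A. 1 / (b' - x) + (1 / w) * (1 / (b' - x)\<^sup>2))"
    by (intro arg_cong[where f = sum_mset] image_mset_cong fg2)
  also have "\<dots> = S + T / w"
    unfolding S_def T_def sum_mset.distrib sum_mset_distrib_left[symmetric] by simp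
  finally have H: "(\<Sum>x\<in>#A. f x * (g x)\<^sup>2) = S + T / w" .
  have "S \<ge> 0" "T \<ge> 0"
    unfolding S_def T_def using lt' by (auto intro!: sum_mset_nonneg simp: less_imp_le)
  have "S\<^sup>2 \<le> (\<Sum>x\<in>#A. f x) * (\<Sum>x\<in>#A. f x * (g x)\<^sup>2)"
    unfolding S using lt
    by (intro sum_mset_mult_square_le) (simp add: f_def less_imp_le)
  also have "\<dots> = (\<Sum>x\<in>#A. f x) * (S + T / w)" by (simp only: H)
  also have "\<dots> \<le> w * (S + T / w)"
    using le \<open>S \<ge> 0\<close> \<open>T \<ge> 0\<close> w by (intro mult_right_mono) (auto simp: f_def)
  also have "\<dots> = w * S + T" using w by (simp add: field_simps)
  finally show "S\<^sup>2 - T \<le> w * S" by simp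
qed

text \<open>The barrier of \<open>p'\<close> at \<open>b'\<close> is \<open>p'' / p'\<close>, which
  equals \<open>(S^2 - T) / S\<close> in terms of the roots of \<open>p\<close>; the shifted
  Cauchy--Schwarz estimate bounds it by \<open>w\<close>.\<close>

lemma barrier_pderiv:
  assumes rr: "real_rooted p" and dg: "degree p \<ge> 2" and w: "w > 0"
    and lt: "\<And>x. x \<in># proots p \<Longrightarrow> x < b" and le: "(\<Sum>x\<in>#proots p. 1 / (b - x)) \<le> w"
  shows "\<And>x. x \<in># proots (pderiv p) \<Longrightarrow> x < b - 1 / w"
    and "(\<Sum>x\<in>#proots (pderiv p). 1 / (b - 1 / w - x)) \<le> w"
proof -
  define b' where "b' = b - 1 / w"
  define A B where "A = proots p" and "B = proots (pderiv p)"
  obtain a where a: "a \<noteq> 0" "p = smult a (from_roots A)"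
    using real_rooted_decompose[OF rr] unfolding A_def .
  have rr': "real_rooted (pderiv p)" using real_rooted_pderiv rr dg by simp
  obtain a' where a': "a' \<noteq> 0" "pderiv p = smult a' (from_roots B)"
    using real_rooted_decompose[OF rr'] unfolding B_def .
  have szA: "size A \<ge> 2" using dg size_proots_real_rooted[OF rr] by (simp add: A_def)
  have lt': "x < b'" if "x \<in># A" for x
    using barrier_sum_shift(1)[OF szA _ w, of b] lt le that by (simp add: A_def b'_def)
  \<comment> \<open>From \<open>b'\<close> on, \<open>p'\<close> is \<open>p\<close> times this
    positive sum, so neither vanishes there.\<close>
  have pos: "(\<Sum>x\<in>#A. 1 / (y - x)) > 0" if "y \<ge> b'" for y
    using szA lt' that by (intro sum_mset_pos) (fastforce simp: field_simps)+
  have pd: "poly (pderiv p) y = a * poly (from_roots A) y * (\<Sum>x\<in>#A. 1 / (y - x))"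
    if "y \<ge> b'" for y
  proof -
    have "y \<notin># A" using lt' that by force
    from poly_pderiv_from_roots[OF this] show ?thesis by (subst a(2)) (simp add: pderiv_smult)
  qed
  show ltB: "y < b - 1 / w" if "y \<in># proots (pderiv p)" for y
  proof (rule ccontr)
    assume "\<not> y < b - 1 / w"
    then have y: "y \<ge> b'" by (simp add: b'_def)
    moreover have "y \<notin># A" using lt' y by force
    ultimately have "poly (pderiv p) y \<noteq> 0" using pos[OF y] a(1) by (simp add: pd)
    moreover have "poly (pderiv p) y = 0"
      using that by (subst a'(2)) (simp add: B_def)
    ultimately show False by simp
  qed
  define P S T where "P = a * poly (from_roots A) b'"
    and "S = (\<Sum>x\<in>#A. 1 / (b' - x))" and "T = (\<Sum>x\<in>#A. 1 / (b' - x)\<^sup>2)"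
  have nA: "b' \<notin># A" using lt' by force
  have nB: "b' \<notin># B" using ltB by (force simp: B_def b'_def)
  have "P \<noteq> 0" using a(1) nA by (simp add: P_def)
  have "S > 0" using pos[of b'] by (simp add: S_def)
  have d1: "poly (pderiv p) b' = P * S" by (simp add: pd P_def S_def)
  have d2: "poly (pderiv (pderiv p)) b' = P * (S\<^sup>2 - T)"
    using poly_pderiv_pderiv_from_roots[OF nA]
    by (subst a(2)) (simp add: pderiv_smult P_def S_def T_def)
  have "poly (pderiv (pderiv p)) b' = a' * poly (from_roots B) b' * (\<Sum>x\<in>#B. 1 / (b' - x))"
    using poly_pderiv_from_roots[OF nB] by (subst a'(2)) (simp add: pderiv_smult)
  also have "a' * poly (from_roots B) b' = P * S"
    unfolding d1[symmetric] by (subst a'(2)) simp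
  finally have "S * (\<Sum>x\<in>#B. 1 / (b' - x)) = S\<^sup>2 - T"
    using d2 \<open>P \<noteq> 0\<close> by simp
  also have "\<dots> \<le> S * w"
    using barrier_sum_shift(2)[OF szA _ w, of b] lt le
    by (simp add: S_def T_def A_def b'_def mult.commute)
  finally show "(\<Sum>x\<in>#proots (pderiv p). 1 / (b - 1 / w - x)) \<le> w"
    using \<open>S > 0\<close> by (simp add: B_def b'_def)
qed

text \<open>The level \<open>w\<close> stays fixed while each derivative moves the point left by
  \<open>1 / w\<close>.\<close>

lemma barrier_higher_pderiv:
  assumes "real_rooted p" and "k < degree p" and "w > 0"
    and "\<And>x. x \<in># proots p \<Longrightarrow> x < b" and "(\<Sum>x\<in>#proots p. 1 / (b - x)) \<le> w"
    and "x \<in># proots ((pderiv ^^ k) p)"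
  shows "x < b - real k / w"
  using assms
proof (induction k arbitrary: p b)
  case (Suc k)
  have "x < b - 1 / w - real k / w"
  proof (rule Suc.IH)
    show "real_rooted (pderiv p)" "k < degree (pderiv p)"
      using Suc.prems by (auto intro: real_rooted_pderiv simp: degree_pderiv)
    show "x \<in># proots ((pderiv ^^ k) (pderiv p))"
      using Suc.prems(6) by (simp add: funpow_swap1)
    \<comment> \<open>From \<open>Suc k < degree p\<close>; this supplies the two roots needed for
      strictness.\<close>
    have dg: "degree p \<ge> 2" using Suc.prems(2) by simp
    note step = barrier_pderiv[OF Suc.prems(1) dg Suc.prems(3,4,5)]
    show "\<And>y. y \<in># proots (pderiv p) \<Longrightarrow> y < b - 1 / w"
      using step(1) by blast
    show "(\<Sum>x\<in>#proots (pderiv p). 1 / (b - 1 / w - x)) \<le> w"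
      using step(2) by blast
  qed fact
  then show ?case by (simp add: add_divide_distrib)
qed simp

subsection \<open>Centred roots in the unit interval\<close>

text \<open>Since \<open>1 / (b - x) = (b + x) / (b^2 - x^2)\<close> and \<open>x^2 \<le> 1\<close>,
  each term has a bound linear in \<open>x\<close>; in the sum the linear part cancels.\<close>

lemma barrier_sum_le:
  fixes A :: "real multiset"
  assumes "set_mset A \<subseteq> {-1..1}" and "\<Sum>\<^sub># A = 0" and "b > 1"
  shows "(\<Sum>x\<in>#A. 1 / (b - x)) \<le> real (size A) * b / (b\<^sup>2 - 1)"
proof -
  have b2: "b\<^sup>2 - 1 > 0" using assms(3) by (simp add: one_less_power)
  have "1 / (b - x) \<le> (b + x) / (b\<^sup>2 - 1)" if "x \<in># A" for x
  proof -
    have "x \<in> {-1..1}" using assms(1) that by blast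
    then have "\<bar>x\<bar> \<le> 1" by auto
    then have "x\<^sup>2 \<le> 1" "b - x > 0" using assms(3) by (auto simp: abs_square_le_1)
    moreover have "(b + x) * (b - x) = b\<^sup>2 - x\<^sup>2" by (simp add: algebra_simps power2_eq_square)
    ultimately show ?thesis using b2 by (simp add: divide_simps)
  qed
  then have "(\<Sum>x\<in>#A. 1 / (b - x)) \<le> (\<Sum>x\<in>#A. (b + x) / (b\<^sup>2 - 1))"
    by (intro sum_mset_mono)
  also have "\<dots> = (real (size A) * b + \<Sum>\<^sub># A) / (b\<^sup>2 - 1)"
    by (induction A) (auto simp: add_divide_distrib algebra_simps)
  finally show ?thesis using assms(2) by simp
qed

lemma higher_pderiv_root_le:
  fixes p :: "real poly"
  assumes rr: "real_rooted p" and dg: "degree p > 0"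
    and I: "set_mset (proots p) \<subseteq> {-1..1}" and sum: "\<Sum>\<^sub># (proots p) = 0"
    and c: "1/2 \<le> c" "c < 1" and k: "real k = c * real (degree p)"
    and x: "poly ((pderiv ^^ k) p) x = 0"
  shows "x \<le> 2 * sqrt (c - c\<^sup>2)"
proof -
  have "real k < real (degree p)" using c dg k by simp
  then have kd: "k < degree p" by simp
  \<comment> \<open>Passing from zeros to \<open>proots\<close> requires a nonzero polynomial, which
    \<open>k < degree p\<close> ensures.\<close>
  have x: "x \<in># proots ((pderiv ^^ k) p)"
    using x real_rooted_higher_pderiv[OF rr kd] by (simp add: real_rooted_def)
  have bd: "x \<le> (1 - c) * b + c / b" if b: "b > 1" for b
  proof -
    have b2: "b\<^sup>2 - 1 > 0" using b by (simp add: one_less_power)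
    define w where "w = real (degree p) * b / (b\<^sup>2 - 1)"
    have "w > 0" using dg b b2 by (simp add: w_def)
    moreover have "(\<Sum>x\<in>#proots p. 1 / (b - x)) \<le> w"
      using barrier_sum_le[OF I sum b] size_proots_real_rooted[OF rr] by (simp add: w_def)
    moreover have "y < b" if "y \<in># proots p" for y using I that b by fastforce
    ultimately have "x < b - real k / w"
      using barrier_higher_pderiv[OF rr kd _ _ _ x] by blast
    also have "real k / w = c * (b\<^sup>2 - 1) / b"
      using dg k by (simp add: w_def)
    also have "b - c * (b\<^sup>2 - 1) / b = (1 - c) * b + c / b"
      using b by (simp add: field_simps power2_eq_square)
    finally show ?thesis by simp
  qed
  \<comment> \<open>The minimiser of the bound is \<open>s / t\<close>, where both summands equal
    \<open>s * t\<close>.\<close>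
  define s t where "s = sqrt c" and "t = sqrt (1 - c)"
  have st: "s > 0" "t > 0" "s\<^sup>2 = c" "t\<^sup>2 = 1 - c" "s \<ge> t"
    using c by (auto simp: s_def t_def)
  \<comment> \<open>For \<open>c = 1/2\<close> the optimal \<open>b\<close> is \<open>1\<close>, which \<open>bd\<close> excludes; so the bound is reached as a limit.\<close>
  have "((\<lambda>b. (1 - c) * b + c / b) \<longlongrightarrow> (1 - c) * (s / t) + c / (s / t)) (at_right (s / t))"
    using st by (intro tendsto_intros) auto
  moreover have "eventually (\<lambda>b. x \<le> (1 - c) * b + c / b) (at_right (s / t))"
  proof -
    \<comment> \<open>Hence every \<open>b > s / t\<close> satisfies \<open>b > 1\<close>. The right
      end \<open>s / t + 1\<close> of the neighbourhood is an arbitrary choice.\<close>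
    have "s / t \<ge> 1" using st by simp
    then show ?thesis
      using bd by (auto simp: eventually_at_right_field intro!: exI[of _ "s / t + 1"])
  qed
  ultimately have "x \<le> (1 - c) * (s / t) + c / (s / t)"
    by (intro tendsto_lowerbound) auto
  also have "(1 - c) * (s / t) = s * t"
    using st(2) by (simp add: st(4)[symmetric] power2_eq_square)
  also have "c / (s / t) = s * t"
    using st(1) by (simp add: st(3)[symmetric] power2_eq_square)
  also have "s * t + s * t = 2 * (s * t)"
    by simp
  also have "s * t = sqrt (c - c\<^sup>2)"
    by (simp add: s_def t_def power2_eq_square algebra_simps flip: real_sqrt_mult)
  finally show ?thesis .
qed

section \<open>Reflection at the origin and the two-sided bound\<close>

lemma higher_pderiv_reflect:
  fixes p :: "'a::idom poly"
  shows "(pderiv ^^ k) (p \<circ>\<^sub>p [:0, -1:]) = smult ((-1) ^ k) ((pderiv ^^ k) p \<circ>\<^sub>p [:0, -1:])"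
  by (induction k) (simp_all add: pderiv_smult pderiv_pcompose pderiv_pCons mult_pCons_right)

text \<open>Real polynomials agree once their values do; each of the \<open>size A\<close> factors
  contributes one sign.\<close>

lemma reflect_smult_from_roots:
  fixes A :: "real multiset"
  shows "smult a (from_roots A) \<circ>\<^sub>p [:0, -1:]
    = smult (a * (-1) ^ size A) (from_roots (image_mset uminus A))"
  by (rule poly_eq_poly_eq_iff[THEN iffD1])
    (auto simp: poly_pcompose poly_from_roots_uminus)

theorem theorem4p4:
  fixes p :: "real poly" and n k :: nat and c :: real
  assumes "real_rooted p"
    and "degree p = n"
    and "set_mset (complex_roots p) \<subseteq> complex_of_real ` {-1..1}"
    and "sum_mset (complex_roots p) = 0"
    and "1/2 \<le> c" and "c < 1"
    and "real k = c * real n"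
  shows "set_mset (complex_roots ((pderiv ^^ k) p))
           \<subseteq> complex_of_real ` {- (2 * sqrt (c - c\<^sup>2)) .. 2 * sqrt (c - c\<^sup>2)}"
proof (cases "n = 0")
  \<comment> \<open>A nonzero constant has no roots, and \<open>k = c * 0\<close> forces
    \<open>k = 0\<close>.\<close>
  case True
  then have "k = 0" and "proots p = {#}"
    using assms size_proots_real_rooted[OF assms(1)] by auto
  then show ?thesis using complex_roots_real_rooted[OF assms(1)] by simp
next
  case False
  let ?q = "(pderiv ^^ k) p"
  define A where "A = proots p"
  obtain a where a: "a \<noteq> 0" "p = smult a (from_roots A)"
    using real_rooted_decompose[OF assms(1)] unfolding A_def .
  have cr: "complex_roots p = image_mset of_real A"
    using complex_roots_real_rooted[OF assms(1)] by (simp add: A_def)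
  have I: "set_mset A \<subseteq> {-1..1}"
    using assms(3) by (auto simp: cr)
  have "complex_of_real (\<Sum>\<^sub># A) = \<Sum>\<^sub># (image_mset of_real A)"
    by (induction A) auto
  then have sum: "\<Sum>\<^sub># A = 0"
    using assms(4) by (simp add: cr)
  have szA: "size A = n" using size_proots_real_rooted assms(1,2) by (simp add: A_def)
  have upper: "x \<le> 2 * sqrt (c - c\<^sup>2)" if "poly ?q x = 0" for x
    using higher_pderiv_root_le[of p c k x] assms False I sum that by (simp add: A_def)
  \<comment> \<open>The upper bound is applied to \<open>p(-x)\<close>: its roots are the negatives,
    again centred in \<open>[-1, 1]\<close>, and its \<open>k\<close>-th derivative vanishes at the
    negative of the given zero.\<close>
  have lower: "- x \<le> 2 * sqrt (c - c\<^sup>2)" if x: "poly ?q x = 0" for x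
  proof -
    define r where "r = smult (a * (-1) ^ size A) (from_roots (image_mset uminus A))"
    have r: "r = p \<circ>\<^sub>p [:0, -1:]"
      unfolding r_def by (subst a(2)) (rule reflect_smult_from_roots[symmetric])
    have nz: "a * (-1) ^ size A \<noteq> 0" using a(1) by simp
    have "proots r = image_mset uminus A" "degree r = n"
      using nz szA by (auto simp: r_def)
    moreover have "\<Sum>\<^sub># (image_mset uminus A) = - \<Sum>\<^sub># A"
      by (induction A) auto
    moreover have "poly ((pderiv ^^ k) r) (- x) = 0"
      using x by (simp add: r higher_pderiv_reflect poly_pcompose)
    moreover have "uminus ` set_mset A \<subseteq> {-1..1}"
      using I by force
    moreover have "real_rooted r"
      unfolding r_def by (rule real_rooted_smult_from_roots[OF nz])
    ultimately show ?thesis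
      using higher_pderiv_root_le[of r c k "- x"] assms(5-7) False I sum by auto
  qed
  have "real k < real n" using assms(5-7) False by simp
  then have rr: "real_rooted ?q" using assms real_rooted_higher_pderiv by simp
  have "x \<in> {- (2 * sqrt (c - c\<^sup>2)) .. 2 * sqrt (c - c\<^sup>2)}" if "x \<in># proots ?q" for x
    using upper[of x] lower[of x] that rr by (simp add: real_rooted_def)
  then show ?thesis
    by (auto simp: complex_roots_real_rooted[OF rr])
qed

end
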